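(* For any $n\times n$ Hermitian matrices $A$, $B$ and $C$, $$\iota(\mathcal{G}_A,\mathcal{G}_B,\mathcal{G}_C) = n_-(B-A) - n_-(C-A) + n_-(C-B).$$
   Context: $\mathbb{C}^n\oplus\mathbb{C}^n$ is equipped with the canonical (sesquilinear) Hermitian symplectic form $\omega((x_1,x_2),(y_1,y_2)) := \langle x_1,y_2\rangle_{\mathbb{C}^n} - \langle x_2,y_1\rangle_{\mathbb{C}^n}$. A subspace $\mathcal{L}$ is Lagrangian if it equals $\{v : \omega(u,v)=0 \text{ for all } u\in\mathcal{L}\}$; $\Lambda(n)$ is the set of Lagrangian planes. For an $n\times n$ Hermitian matrix $M$, $\mathcal{G}_M := \{(x,Mx): x\in\mathbb{C}^n\}\in\Lambda(n)$, and $\mathcal{G}_\infty := 0\oplus\mathbb{C}^n$. $n_-$ is the number of negative eigenvalues counted with multiplicity. The Duistermaat index $\iota:\Lambda(n)^3\to\{0,\dots,n\}$ is the unique function such that (1) $\iota(\mathcal{G}_0,\mathcal{G}_A,\mathcal{G}_\infty)=n_-(A)$ for every Hermitian $A$; (2) $\iota(\mathsf{S}\mathcal{L}_1,\mathsf{S}\mathcal{L}_2,\mathsf{S}\mathcal{L}_3)=\iota(\mathcal{L}_1,\mathcal{L}_2,\mathcal{L}_3)$ for every linear symplectic transformation $\mathsf{S}$; (3) $\iota(\mathcal{L}_1,\mathcal{L}_2,\mathcal{L}_3)-\iota(\mathcal{L}_1,\mathcal{L}_2,\mathcal{L}_4)+\iota(\mathcal{L}_1,\mathcal{L}_3,\mathcal{L}_4)-\iota(\mathcal{L}_2,\mathcal{L}_3,\mathcal{L}_4)=0$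 for all Lagrangian planes. Explicitly, $\iota(\mathcal{L}_1,\mathcal{L}_2,\mathcal{L}_3)=n_-(\Omega)-n+\dim(\mathcal{L}_1\cap\mathcal{L}_3)$, where $\Omega$ is the Hermitian form on $\mathcal{L}_1\oplus\mathcal{L}_2\oplus\mathcal{L}_3$ given by $\Omega(u_1,u_2,u_3;v_1,v_2,v_3)=\omega(u_1,v_2)+\omega(u_2,v_3)+\omega(u_3,v_1)-\omega(u_2,v_1)-\omega(u_3,v_2)-\omega(u_1,v_3)$. *)

theory Defs
  imports "HOL-Analysis.Analysis"
begin

interpretation sympl: finite_dimensional_vector_space_prod
  "(*s) :: complex \<Rightarrow> complex^'n \<Rightarrow> complex^'n"
  "(*s) :: complex \<Rightarrow> complex^'n \<Rightarrow> complex^'n" cart_basis cart_basis ..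

definition cinner :: "complex^'n \<Rightarrow> complex^'n \<Rightarrow> complex" where
  "cinner x y = (\<Sum>i\<in>UNIV. cnj (x $ i) * y $ i)"

definition omega :: "(complex^'n) \<times> (complex^'n) \<Rightarrow> (complex^'n) \<times> (complex^'n) \<Rightarrow> complex" where
  "omega u v = cinner (fst u) (snd v) - cinner (snd u) (fst v)"

definition Lagrangian :: "((complex^'n) \<times> (complex^'n)) set set" where
  "Lagrangian = {L. sympl.p.subspace L \<and> L = {v. \<forall>u\<in>L. omega u v = 0}}"

definition symplectic :: "((complex^'n) \<times> (complex^'n) \<Rightarrow> (complex^'n) \<times> (complex^'n)) \<Rightarrow> bool" where
  "symplectic S \<longleftrightarrow> Vector_Spaces.linear sympl.scale sympl.scale S \<and>
     (\<forall>u v. omega (S u) (S v) = omega u v)"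

definition hermitian_matrix :: "complex^'n^'n \<Rightarrow> bool" where
  "hermitian_matrix A \<longleftrightarrow> (\<forall>i j. A $ i $ j = cnj (A $ j $ i))"

definition eigenspace :: "complex^'n^'n \<Rightarrow> complex \<Rightarrow> (complex^'n) set" where
  "eigenspace A l = {x. A *v x = l *s x}"

text \<open>The number of negative eigenvalues, each counted with its multiplicity. It is only applied
  to Hermitian matrices, for which algebraic and geometric multiplicities agree.\<close>

definition n_minus :: "complex^'n^'n \<Rightarrow> nat" where
  "n_minus A = (\<Sum>l\<in>{l::real. l < 0 \<and> (\<exists>x. x \<noteq> 0 \<and> A *v x = complex_of_real l *s x)}.
                  vec.dim (eigenspace A (complex_of_real l)))"

definition lagr_graph :: "complex^'n^'n \<Rightarrow> ((complex^'n) \<times> (complex^'n)) set" where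
  "lagr_graph M = {(x, M *v x) | x. True}"

definition lagr_graph_inf :: "((complex^'n) \<times> (complex^'n)) set" where
  "lagr_graph_inf = {0} \<times> UNIV"

text \<open>The defining properties of the Duistermaat index. The extensional function space makes a
  function on triples of Lagrangian planes unique as a total HOL function.\<close>

definition is_duistermaat_index ::
  "(((complex^'n) \<times> (complex^'n)) set \<times> ((complex^'n) \<times> (complex^'n)) set \<times>
    ((complex^'n) \<times> (complex^'n)) set \<Rightarrow> nat) \<Rightarrow> bool" where
  "is_duistermaat_index \<iota> \<longleftrightarrow>
     \<iota> \<in> (Lagrangian \<times> Lagrangian \<times> Lagrangian) \<rightarrow>\<^sub>E {0..CARD('n)} \<and>
     (\<forall>A. hermitian_matrix A \<longrightarrow> \<iota> (lagr_graph 0, lagr_graph A, lagr_graph_inf) = n_minus A) \<and>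
     (\<forall>S. symplectic S \<longrightarrow>
        (\<forall>L1\<in>Lagrangian. \<forall>L2\<in>Lagrangian. \<forall>L3\<in>Lagrangian.
           \<iota> (S ` L1, S ` L2, S ` L3) = \<iota> (L1, L2, L3))) \<and>
     (\<forall>L1\<in>Lagrangian. \<forall>L2\<in>Lagrangian. \<forall>L3\<in>Lagrangian. \<forall>L4\<in>Lagrangian.
        int (\<iota> (L1, L2, L3)) - int (\<iota> (L1, L2, L4)) + int (\<iota> (L1, L3, L4))
          - int (\<iota> (L2, L3, L4)) = 0)"

definition duistermaat_index ::
  "((complex^'n) \<times> (complex^'n)) set \<times> ((complex^'n) \<times> (complex^'n)) set \<times>
    ((complex^'n) \<times> (complex^'n)) set \<Rightarrow> nat" where
  "duistermaat_index = (THE \<iota>. is_duistermaat_index \<iota>)"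

end

theory Submission
  imports Defs
begin

text \<open>
  Any index with the three defining properties satisfies the formula: the cocycle identity for
  \<open>\<G>\<^sub>A, \<G>\<^sub>B, \<G>\<^sub>C, \<G>\<^sub>\<infinity>\<close> reduces it to the indices of \<open>(\<G>\<^sub>A, \<G>\<^sub>B, \<G>\<^sub>\<infinity>)\<close>, which a shear moves to
  \<open>(\<G>\<^sub>0, \<G>\<^bsub>B - A\<^esub>, \<G>\<^sub>\<infinity>)\<close>. The index exists and is unique because, for all but finitely many
  real \<open>t\<close>, the symplectic map \<open>(x, y) \<mapsto> (y - t x, - x)\<close> turns any finite set of Lagrangian planes
  into graphs of Hermitian matrices. Uniqueness follows at once; for existence, the
  explicit formula in terms of the form \<open>\<Omega>\<close> is symplectically invariant, and on graphs it equals
  \<open>n\<^sub>-(B - A) - n\<^sub>-(C - A) + n\<^sub>-(C - B)\<close>, from which the cocycle identity is evident.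
\<close>

section \<open>Negative index of a form\<close>

definition neg_definite_on :: "('a::zero \<Rightarrow> real) \<Rightarrow> 'a set \<Rightarrow> bool" where
  "neg_definite_on q W \<longleftrightarrow> (\<forall>x\<in>W. x \<noteq> 0 \<longrightarrow> q x < 0)"

definition neg_index :: "('a::euclidean_space \<Rightarrow> real) \<Rightarrow> 'a set \<Rightarrow> nat" where
  "neg_index q V = Max {dim W | W. subspace W \<and> W \<subseteq> V \<and> neg_definite_on q W}"

lemma finite_dims_neg_definite:
  fixes V :: "'a::euclidean_space set"
  shows "finite {dim W | W. subspace W \<and> W \<subseteq> V \<and> neg_definite_on q W}"
  by (rule finite_subset[of _ "{..DIM('a)}"]) (auto simp: dim_subset_UNIV)

lemma dim_le_neg_index:
  fixes V W :: "'a::euclidean_space set"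
  assumes "subspace W" "W \<subseteq> V" "neg_definite_on q W"
  shows "dim W \<le> neg_index q V"
  unfolding neg_index_def using assms by (intro Max_ge finite_dims_neg_definite) blast

lemma neg_index_attained:
  fixes V :: "'a::euclidean_space set"
  assumes "subspace V"
  obtains W where "subspace W" "W \<subseteq> V" "neg_definite_on q W" "dim W = neg_index q V"
proof -
  have "subspace {0::'a} \<and> {0} \<subseteq> V \<and> neg_definite_on q {0}"
    using subspace_0[OF assms] by (simp add: neg_definite_on_def)
  then have "{dim W | W. subspace W \<and> W \<subseteq> V \<and> neg_definite_on q W} \<noteq> {}"
    by blast
  from Max_in[OF finite_dims_neg_definite this] show ?thesis
    using that unfolding neg_index_def by force
qed

lemma neg_index_image:
  fixes f :: "'a::euclidean_space \<Rightarrow> 'b::euclidean_space"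
  assumes f: "linear f" and inj: "inj f" and V: "subspace V"
  shows "neg_index q (f ` V) = neg_index (q \<circ> f) V"
proof (rule antisym)
  have eq_0_iff: "f x = 0 \<longleftrightarrow> x = 0" for x
    using inj linear_0[OF f] by (metis injD)
  have dim_image: "dim (f ` W) = dim W" for W
    by (rule dim_image_eq[OF f inj_on_subset[OF inj subset_UNIV]])
  obtain W where W: "subspace W" "W \<subseteq> f ` V" "neg_definite_on q W" "dim W = neg_index q (f ` V)"
    by (rule neg_index_attained[OF linear_subspace_image[OF f V]])
  have "f ` (f -` W) = W"
    using W(2) by auto
  then have "dim (f -` W) = dim W"
    using dim_image[of "f -` W"] by simp
  moreover have "dim (f -` W) \<le> neg_index (q \<circ> f) V"
  proof (rule dim_le_neg_index)
    show "subspace (f -` W)"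
      by (rule linear_subspace_vimage[OF f W(1)])
    show "f -` W \<subseteq> V"
      using W(2) inj by (auto simp: inj_def)
    show "neg_definite_on (q \<circ> f) (f -` W)"
      using W(3) by (simp add: neg_definite_on_def eq_0_iff)
  qed
  ultimately show "neg_index q (f ` V) \<le> neg_index (q \<circ> f) V"
    using W(4) by simp
  obtain U where U: "subspace U" "U \<subseteq> V" "neg_definite_on (q \<circ> f) U"
      "dim U = neg_index (q \<circ> f) V"
    by (rule neg_index_attained[OF V])
  have "dim (f ` U) \<le> neg_index q (f ` V)"
    using U(2,3)
    by (intro dim_le_neg_index linear_subspace_image[OF f U(1)] image_mono)
      (auto simp: neg_definite_on_def eq_0_iff)
  then show "neg_index (q \<circ> f) V \<le> neg_index q (f ` V)"
    using U(4) dim_image by simp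
qed

definition sign_splitting ::
  "('a::euclidean_space \<Rightarrow> real) \<Rightarrow> 'a set \<Rightarrow> 'a set \<Rightarrow> bool" where
  "sign_splitting q N P \<longleftrightarrow> subspace N \<and> subspace P \<and> {x + y | x y. x \<in> N \<and> y \<in> P} = UNIV \<and>
     neg_definite_on q N \<and> (\<forall>x\<in>P. 0 \<le> q x)"

lemma dim_add_le_dim_Int:
  fixes W P :: "'a::euclidean_space set"
  assumes "subspace W" "subspace P"
  shows "dim W + dim P \<le> DIM('a) + dim (W \<inter> P)"
  using dim_sums_Int[OF assms] dim_subset_UNIV[of "{x + y | x y. x \<in> W \<and> y \<in> P}"] by linarith

lemma dim_neg_definite_Int_nonneg:
  fixes W P :: "'a::euclidean_space set"
  assumes "neg_definite_on q W" "\<forall>x\<in>P. 0 \<le> q x"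
  shows "dim (W \<inter> P) = 0"
  using assms unfolding neg_definite_on_def dim_eq_0 by force

lemma sign_splitting_dim:
  fixes N P :: "'a::euclidean_space set"
  assumes "sign_splitting q N P"
  shows "dim N + dim P = DIM('a)"
  using dim_sums_Int[of N P] dim_neg_definite_Int_nonneg[of q N P] assms
  by (simp add: sign_splitting_def del: dim_eq_0)

lemma sign_splitting_neg_index:
  assumes split: "sign_splitting q N P"
  shows "neg_index q UNIV = dim N"
proof (rule antisym)
  obtain W where W: "subspace W" "neg_definite_on q W" "dim W = neg_index q UNIV"
    by (rule neg_index_attained[OF subspace_UNIV])
  show "neg_index q UNIV \<le> dim N"
    using dim_add_le_dim_Int[OF W(1), of P] dim_neg_definite_Int_nonneg[OF W(2), of P]
      sign_splitting_dim[OF split] split W(3)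
    by (simp add: sign_splitting_def del: dim_eq_0)
  show "dim N \<le> neg_index q UNIV"
    using split by (simp add: dim_le_neg_index sign_splitting_def)
qed

text \<open>A subspace on which \<open>q + r\<close> is negative definite meets \<open>P\<close> in one on which \<open>r\<close> is.\<close>

lemma neg_index_add_le:
  assumes split: "sign_splitting q N P"
  shows "neg_index (\<lambda>x. q x + r x) UNIV \<le> neg_index q UNIV + neg_index r UNIV"
proof -
  have P: "subspace P" "\<forall>x\<in>P. 0 \<le> q x"
    using split by (auto simp: sign_splitting_def)
  obtain W where W: "subspace W" "neg_definite_on (\<lambda>x. q x + r x) W"
      "dim W = neg_index (\<lambda>x. q x + r x) UNIV"
    by (rule neg_index_attained[OF subspace_UNIV])
  have "neg_definite_on r (W \<inter> P)"
    using W(2) P(2) unfolding neg_definite_on_def by force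
  then have "dim (W \<inter> P) \<le> neg_index r UNIV"
    by (intro dim_le_neg_index subspace_inter W(1) P(1)) auto
  then show ?thesis
    using dim_add_le_dim_Int[OF W(1) P(1)] sign_splitting_dim[OF split] W(3)
    by (simp add: sign_splitting_neg_index[OF split])
qed

lemma sign_splitting_Times:
  assumes q: "sign_splitting q N P" "q 0 = 0" and r: "sign_splitting r N' P'" "r 0 = 0"
  shows "sign_splitting (\<lambda>(x, y). q x + r y) (N \<times> N') (P \<times> P')"
  unfolding sign_splitting_def
proof (intro conjI)
  show "subspace (N \<times> N')" "subspace (P \<times> P')"
    using q r by (simp_all add: sign_splitting_def subspace_Times)
  have "(x, y) \<in> {u + v | u v. u \<in> N \<times> N' \<and> v \<in> P \<times> P'}" for x y
  proof -
    obtain x1 x2 where x: "x = x1 + x2" "x1 \<in> N" "x2 \<in> P"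
      using q unfolding sign_splitting_def by blast
    obtain y1 y2 where y: "y = y1 + y2" "y1 \<in> N'" "y2 \<in> P'"
      using r unfolding sign_splitting_def by blast
    have "(x, y) = (x1, y1) + (x2, y2)"
      by (simp add: x y)
    then show ?thesis
      using x y by blast
  qed
  then show "{u + v | u v. u \<in> N \<times> N' \<and> v \<in> P \<times> P'} = UNIV"
    by auto
  show "neg_definite_on (\<lambda>(x, y). q x + r y) (N \<times> N')"
    unfolding neg_definite_on_def
  proof clarify
    fix x y assume xy: "x \<in> N" "y \<in> N'" "(x, y) \<noteq> 0"
    have "q x < 0 \<or> x = 0" "r y < 0 \<or> y = 0"
      using q r xy(1,2) by (auto simp: sign_splitting_def neg_definite_on_def)
    then show "q x + r y < 0"
      using q(2) r(2) xy(3) by (auto simp: zero_prod_def)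
  qed
  show "\<forall>z\<in>P \<times> P'. 0 \<le> (case z of (x, y) \<Rightarrow> q x + r y)"
    using q r by (auto simp: sign_splitting_def)
qed

lemma neg_index_Times:
  assumes q: "sign_splitting q N P" "q 0 = 0" and r: "sign_splitting r N' P'" "r 0 = 0"
  shows "neg_index (\<lambda>(x, y). q x + r y) UNIV = neg_index q UNIV + neg_index r UNIV"
proof -
  have "neg_index (\<lambda>(x, y). q x + r y) UNIV = dim (N \<times> N')"
    by (rule sign_splitting_neg_index[OF sign_splitting_Times[OF q r]])
  also have "\<dots> = dim N + dim N'"
    using q(1) r(1) by (simp add: dim_Times sign_splitting_def)
  finally show ?thesis
    by (simp add: sign_splitting_neg_index[OF q(1)] sign_splitting_neg_index[OF r(1)])
qed

lemma sign_splitting_hyperbolic: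
  "sign_splitting (\<lambda>(x, y). - (x \<bullet> y)) (range (\<lambda>x. (x, x))) (range (\<lambda>x. (x, - x)))"
  (is "sign_splitting ?q ?N ?P")
  unfolding sign_splitting_def
proof (intro conjI)
  show "subspace ?N" "subspace ?P"
    by (auto intro!: linear_subspace_image linearI simp: scaleR_Pair)
  have "(x, y) \<in> {u + v | u v. u \<in> ?N \<and> v \<in> ?P}" for x y :: 'a
  proof -
    have half_sum: "(1/2) *\<^sub>R v + (1/2) *\<^sub>R v = v" for v :: 'a
      by (simp flip: scaleR_add_left)
    define s d where "s = (1/2) *\<^sub>R (x + y)" and "d = (1/2) *\<^sub>R (x - y)"
    have "s + d = (1/2) *\<^sub>R x + (1/2) *\<^sub>R x" "s - d = (1/2) *\<^sub>R y + (1/2) *\<^sub>R y"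
      by (simp_all add: s_def d_def algebra_simps)
    then have "(x, y) = (s, s) + (d, - d)"
      by (simp add: half_sum)
    then show ?thesis
      by blast
  qed
  then show "{u + v | u v. u \<in> ?N \<and> v \<in> ?P} = UNIV"
    by auto
qed (auto simp: neg_definite_on_def zero_prod_def)

lemma neg_index_hyperbolic:
  "neg_index (\<lambda>(x, y). - (x \<bullet> y)) (UNIV :: ('a::euclidean_space \<times> 'a) set) = DIM('a)"
proof -
  have "dim (range (\<lambda>x::'a. (x, x))) = dim (UNIV :: 'a set)"
    by (rule dim_image_eq) (auto intro!: linearI inj_onI simp: scaleR_Pair)
  then show ?thesis
    unfolding sign_splitting_neg_index[OF sign_splitting_hyperbolic] by simp
qed

section \<open>Self-adjoint operators on Euclidean spaces\<close>

definition self_adjoint :: "('a::real_inner \<Rightarrow> 'a) \<Rightarrow> bool" where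
  "self_adjoint f \<longleftrightarrow> (\<forall>x y. f x \<bullet> y = x \<bullet> f y)"

definition quad_form :: "('a::real_inner \<Rightarrow> 'a) \<Rightarrow> 'a \<Rightarrow> real" where
  "quad_form f x = x \<bullet> f x"

lemma self_adjointD: "self_adjoint f \<Longrightarrow> f x \<bullet> y = x \<bullet> f y"
  by (simp add: self_adjoint_def)

lemma self_adjoint_linear:
  assumes "self_adjoint f"
  shows "linear f"
proof (rule linearI)
  show "f (x + y) = f x + f y" for x y
    by (rule vector_eq_rdot[THEN iffD1])
      (simp add: self_adjointD[OF assms] inner_add_left)
  show "f (c *\<^sub>R x) = c *\<^sub>R f x" for c x
    by (rule vector_eq_rdot[THEN iffD1]) (simp add: self_adjointD[OF assms])
qed

lemma self_adjoint_uminus: "self_adjoint f \<Longrightarrow> self_adjoint (\<lambda>x. - f x)"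
  by (simp add: self_adjoint_def)

lemma quad_form_zero: "quad_form f 0 = 0"
  by (simp add: quad_form_def)

lemma quad_form_scaleR: "self_adjoint f \<Longrightarrow> quad_form f (c *\<^sub>R x) = c\<^sup>2 * quad_form f x"
  by (simp add: quad_form_def linear_scale[OF self_adjoint_linear] power2_eq_square)

lemma quad_form_add:
  assumes "self_adjoint f"
  shows "quad_form f (x + y) = quad_form f x + 2 * (y \<bullet> f x) + quad_form f y"
  using self_adjointD[OF assms, of x y]
  by (simp add: quad_form_def linear_add[OF self_adjoint_linear[OF assms]] inner_add_left
      inner_add_right inner_commute)

lemma linear_plus_quadratic_nonneg_imp_0:
  fixes b c :: real
  assumes "\<And>t. 0 \<le> t * b + t\<^sup>2 * c"
  shows "b = 0"
proof (rule ccontr)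
  assume "b \<noteq> 0"
  define t where "t = - b / (\<bar>c\<bar> + 1)"
  have "t\<^sup>2 * c \<le> t\<^sup>2 * \<bar>c\<bar>"
    by (simp add: mult_left_mono)
  also have "\<dots> < t\<^sup>2 * (\<bar>c\<bar> + 1)"
    using \<open>b \<noteq> 0\<close> by (intro mult_strict_left_mono) (auto simp: t_def)
  also have "\<dots> = - (t * b)"
    by (simp add: t_def power2_eq_square)
  finally show False
    using assms[of t] by linarith
qed

lemma isotropic_imp_orthogonal_if_nonneg:
  assumes g: "self_adjoint g" and V: "subspace V" and nonneg: "\<And>z. z \<in> V \<Longrightarrow> 0 \<le> quad_form g z"
    and x: "x \<in> V" "quad_form g x = 0" and y: "y \<in> V"
  shows "y \<bullet> g x = 0"
proof -
  have "0 \<le> t * (2 * (y \<bullet> g x)) + t\<^sup>2 * quad_form g y" for t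
  proof -
    have "x + t *\<^sub>R y \<in> V"
      using V x(1) y by (simp add: subspace_add subspace_scale)
    from nonneg[OF this] show ?thesis
      by (simp add: quad_form_add[OF g] quad_form_scaleR[OF g] x(2) mult.left_commute)
  qed
  then have "2 * (y \<bullet> g x) = 0"
    by (rule linear_plus_quadratic_nonneg_imp_0)
  then show ?thesis
    by simp
qed

lemma quad_form_attains_max_on_subspace:
  fixes f :: "'a::euclidean_space \<Rightarrow> 'a"
  assumes f: "self_adjoint f" and V: "subspace V" "V \<noteq> {0}"
  obtains x where "x \<in> V" "norm x = 1" "\<And>z. z \<in> V \<Longrightarrow> quad_form f z \<le> quad_form f x * (norm z)\<^sup>2"
proof -
  define S where "S = sphere 0 1 \<inter> V"
  have normalize: "z /\<^sub>R norm z \<in> S" if "z \<in> V" "z \<noteq> 0" for z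
    using that subspace_scale[OF V(1)] by (simp add: S_def)
  have "compact S"
    unfolding S_def by (intro compact_Int_closed compact_sphere closed_subspace V)
  moreover have "S \<noteq> {}"
    using normalize V(2) subspace_0[OF V(1)] by blast
  moreover have "continuous_on S (quad_form f)"
    unfolding quad_form_def
    by (intro continuous_on_inner continuous_on_id linear_continuous_on
        linear_conv_bounded_linear[THEN iffD1] self_adjoint_linear f)
  ultimately obtain x where x: "x \<in> S" "\<And>z. z \<in> S \<Longrightarrow> quad_form f z \<le> quad_form f x"
    using continuous_attains_sup[of S "quad_form f"] by blast
  show ?thesis
  proof (rule that)
    show "x \<in> V" "norm x = 1"
      using x(1) by (auto simp: S_def)
    show "quad_form f z \<le> quad_form f x * (norm z)\<^sup>2" if "z \<in> V" for z
    proof (cases "z = 0")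
      case False
      have "quad_form f z = (norm z)\<^sup>2 * quad_form f (z /\<^sub>R norm z)"
        using False by (simp add: quad_form_scaleR[OF f] power_inverse)
      then show ?thesis
        using x(2)[OF normalize[OF that False]]
        by (metis mult.commute mult_left_mono zero_le_power2)
    qed (simp add: quad_form_def)
  qed
qed

text \<open>The maximiser of the Rayleigh quotient is an eigenvector.\<close>

lemma self_adjoint_eigenvector_in_subspace:
  fixes f :: "'a::euclidean_space \<Rightarrow> 'a"
  assumes f: "self_adjoint f" and V: "subspace V" "V \<noteq> {0}" and inv: "f ` V \<subseteq> V"
  obtains x l where "x \<in> V" "x \<noteq> 0" "f x = l *\<^sub>R x"
proof -
  obtain x where x: "x \<in> V" "norm x = 1"
      and max: "\<And>z. z \<in> V \<Longrightarrow> quad_form f z \<le> quad_form f x * (norm z)\<^sup>2"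
    by (rule quad_form_attains_max_on_subspace[OF f V]) blast
  define g where "g z = quad_form f x *\<^sub>R z - f z" for z
  have quad_g: "quad_form g z = quad_form f x * (norm z)\<^sup>2 - quad_form f z" for z
    by (simp add: quad_form_def g_def inner_diff_right power2_norm_eq_inner)
  have "self_adjoint g"
    using self_adjointD[OF f]
    by (simp add: self_adjoint_def g_def inner_diff_left inner_diff_right)
  moreover have "g x \<in> V"
    unfolding g_def using inv by (intro subspace_diff subspace_scale V x(1)) (use x(1) in blast)
  ultimately have "g x \<bullet> g x = 0"
    using max x by (intro isotropic_imp_orthogonal_if_nonneg[of g V]) (simp_all add: V quad_g)
  then have "f x = quad_form f x *\<^sub>R x"
    by (simp add: g_def)
  moreover have "x \<noteq> 0"
    using x(2) by auto
  ultimately show ?thesis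
    using that x(1) by blast
qed

theorem self_adjoint_span_eigenvectors:
  fixes f :: "'a::euclidean_space \<Rightarrow> 'a"
  assumes f: "self_adjoint f"
  shows "span {x. \<exists>l. f x = l *\<^sub>R x} = UNIV" (is "span ?E = UNIV")
proof (rule ccontr)
  assume "span ?E \<noteq> UNIV"
  define V where "V = {y. \<forall>x\<in>?E. x \<bullet> y = 0}"
  have "subspace V"
    by (auto simp: V_def subspace_def inner_add_right)
  moreover have "V \<noteq> {0}"
  proof -
    obtain y where "y \<noteq> 0" "\<forall>x\<in>span ?E. y \<bullet> x = 0"
      using span_not_UNIV_orthogonal[OF \<open>span ?E \<noteq> UNIV\<close>] by blast
    then have "y \<in> V"
      by (auto simp: V_def inner_commute intro: span_base)
    then show ?thesis
      using \<open>y \<noteq> 0\<close> by blast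
  qed
  moreover have "f ` V \<subseteq> V"
    by (auto simp: V_def simp flip: self_adjointD[OF f])
  ultimately obtain x l where "x \<in> V" "x \<noteq> 0" "f x = l *\<^sub>R x"
    by (rule self_adjoint_eigenvector_in_subspace[OF f])
  then show False
    by (auto simp: V_def)
qed

locale orthonormal_eigenbasis =
  fixes f :: "'a::euclidean_space \<Rightarrow> 'a" and B :: "'a set" and l :: "'a \<Rightarrow> real"
  assumes self_adjoint: "self_adjoint f"
    and orthogonal: "pairwise orthogonal B"
    and norm_eq_1: "b \<in> B \<Longrightarrow> norm b = 1"
    and span_eq_UNIV: "span B = UNIV"
    and eigenvector: "b \<in> B \<Longrightarrow> f b = l b *\<^sub>R b"
begin

lemma independent: "independent B"
  using pairwise_orthogonal_independent[OF orthogonal] norm_eq_1 by force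

lemma finite: "finite B"
  using independent_bound[OF independent] by simp

lemma card_eq_DIM: "card B = DIM('a)"
  using dim_eq_card_independent[OF independent] dim_span[of B] by (simp add: span_eq_UNIV)

lemma dim_span_subset: "C \<subseteq> B \<Longrightarrow> dim (span C) = card C"
  using independent_mono[OF independent] by (simp add: dim_eq_card_independent)

lemma expansion: "(\<Sum>b\<in>B. (x \<bullet> b) *\<^sub>R b) = x"
  by (rule orthonormal_basis_expand[OF orthogonal norm_eq_1 _ finite])
    (simp_all add: span_eq_UNIV)

lemma in_span_subset_iff:
  assumes "C \<subseteq> B"
  shows "x \<in> span C \<longleftrightarrow> (\<forall>b\<in>B - C. x \<bullet> b = 0)"
proof
  assume x: "x \<in> span C"
  show "\<forall>b\<in>B - C. x \<bullet> b = 0"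
  proof
    fix b assume "b \<in> B - C"
    then have "orthogonal b c" if "c \<in> C" for c
      using that assms orthogonal by (metis DiffD1 DiffD2 pairwiseD subsetD)
    then show "x \<bullet> b = 0"
      using orthogonal_to_span[OF x, of b] by (simp add: orthogonal_def inner_commute)
  qed
next
  assume "\<forall>b\<in>B - C. x \<bullet> b = 0"
  then have "(\<Sum>b\<in>B. (x \<bullet> b) *\<^sub>R b) = (\<Sum>b\<in>C. (x \<bullet> b) *\<^sub>R b)"
    using assms finite by (intro sum.mono_neutral_right) auto
  then have "x = (\<Sum>b\<in>C. (x \<bullet> b) *\<^sub>R b)"
    by (simp add: expansion)
  also have "\<dots> \<in> span C"
    by (intro span_sum span_scale span_base)
  finally show "x \<in> span C" .
qed

lemma inner_image_eigenvector: "b \<in> B \<Longrightarrow> f x \<bullet> b = l b * (x \<bullet> b)"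
  by (simp add: self_adjointD[OF self_adjoint] eigenvector)

lemma quad_form_eq_sum: "quad_form f x = (\<Sum>b\<in>B. l b * (x \<bullet> b)\<^sup>2)"
proof -
  have "quad_form f x = f x \<bullet> (\<Sum>b\<in>B. (x \<bullet> b) *\<^sub>R b)"
    by (simp only: expansion) (simp add: quad_form_def inner_commute)
  also have "\<dots> = (\<Sum>b\<in>B. l b * (x \<bullet> b)\<^sup>2)"
    by (simp add: inner_sum_right inner_image_eigenvector power2_eq_square algebra_simps)
  finally show ?thesis .
qed

lemma eigenspace_eq_span: "{x. f x = t *\<^sub>R x} = span {b \<in> B. l b = t}"
proof -
  have "f x = t *\<^sub>R x \<longleftrightarrow> (\<forall>b\<in>B. f x \<bullet> b = t * (x \<bullet> b))" for x
    using expansion[of "f x"] expansion[of "t *\<^sub>R x"]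
    by (metis (no_types, lifting) inner_scaleR_left sum.cong)
  then show ?thesis
    using in_span_subset_iff[of "{b \<in> B. l b = t}"] by (auto simp: inner_image_eigenvector)
qed

lemma quad_form_neg_definite: "neg_definite_on (quad_form f) (span {b \<in> B. l b < 0})"
  unfolding neg_definite_on_def
proof (intro ballI impI)
  fix x assume x: "x \<in> span {b \<in> B. l b < 0}" "x \<noteq> 0"
  have neg: "l b < 0" if "b \<in> B" "x \<bullet> b \<noteq> 0" for b
    using x(1) that in_span_subset_iff[of "{b \<in> B. l b < 0}" x] by auto
  obtain b where b: "b \<in> B" "x \<bullet> b \<noteq> 0"
    using expansion[of x] x(2) by (metis (no_types, lifting) scaleR_zero_left sum.neutral)
  have "(\<Sum>b\<in>B. l b * (x \<bullet> b)\<^sup>2) < (\<Sum>b\<in>B. 0)"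
  proof (rule sum_strict_mono_ex1)
    show "\<forall>b\<in>B. l b * (x \<bullet> b)\<^sup>2 \<le> 0"
      using neg by (fastforce intro: mult_nonpos_nonneg)
    show "\<exists>b\<in>B. l b * (x \<bullet> b)\<^sup>2 < 0"
      using b neg by (intro bexI[of _ b] mult_neg_pos) auto
  qed (rule finite)
  then show "quad_form f x < 0"
    by (simp add: quad_form_eq_sum)
qed

lemma sign_splitting:
  "sign_splitting (quad_form f) (span {b \<in> B. l b < 0}) (span {b \<in> B. 0 \<le> l b})"
  unfolding sign_splitting_def
proof (intro conjI ballI)
  have "{b \<in> B. l b < 0} \<union> {b \<in> B. 0 \<le> l b} = B"
    by auto
  then show "{x + y | x y. x \<in> span {b \<in> B. l b < 0} \<and> y \<in> span {b \<in> B. 0 \<le> l b}} = UNIV"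
    by (simp add: span_eq_UNIV flip: span_Un)
next
  fix x assume "x \<in> span {b \<in> B. 0 \<le> l b}"
  then have "0 \<le> l b" if "b \<in> B" "x \<bullet> b \<noteq> 0" for b
    using that in_span_subset_iff[of "{b \<in> B. 0 \<le> l b}" x] by auto
  then show "0 \<le> quad_form f x"
    unfolding quad_form_eq_sum by (intro sum_nonneg) force
qed (simp_all add: quad_form_neg_definite)

lemma neg_index_eq_card: "neg_index (quad_form f) UNIV = card {b \<in> B. l b < 0}"
  by (simp add: sign_splitting_neg_index[OF sign_splitting] dim_span_subset del: dim_span)

lemma neg_index_eq_sum_dims:
  "neg_index (quad_form f) UNIV =
    (\<Sum>t | t < 0 \<and> (\<exists>x. x \<noteq> 0 \<and> f x = t *\<^sub>R x). dim {x. f x = t *\<^sub>R x})"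
proof -
  have "{t. t < 0 \<and> (\<exists>x. x \<noteq> 0 \<and> f x = t *\<^sub>R x)} = l ` {b \<in> B. l b < 0}" (is "?T = _")
  proof (intro set_eqI iffI)
    fix t assume "t \<in> ?T"
    then have "t < 0" "\<not> span {b \<in> B. l b = t} \<subseteq> {0}"
      by (auto simp flip: eigenspace_eq_span)
    then show "t \<in> l ` {b \<in> B. l b < 0}"
      by (cases "{b \<in> B. l b = t} = {}") auto
  next
    fix t assume "t \<in> l ` {b \<in> B. l b < 0}"
    then obtain b where "b \<in> B" "t = l b" "l b < 0"
      by blast
    moreover from this have "b \<noteq> 0"
      using norm_eq_1[of b] by auto
    ultimately show "t \<in> ?T"
      using eigenvector by blast
  qed
  then have "(\<Sum>t\<in>?T. dim {x. f x = t *\<^sub>R x}) = (\<Sum>t\<in>l ` {b \<in> B. l b < 0}. card {b \<in> B. l b = t})"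
    by (simp add: eigenspace_eq_span dim_span_subset del: dim_span)
  also have "\<dots> = card (\<Union>t\<in>l ` {b \<in> B. l b < 0}. {b \<in> B. l b = t})"
    using finite by (subst card_UN_disjoint) auto
  also have "(\<Union>t\<in>l ` {b \<in> B. l b < 0}. {b \<in> B. l b = t}) = {b \<in> B. l b < 0}"
    by auto
  finally show ?thesis
    by (simp add: neg_index_eq_card)
qed

lemma uminus: "orthonormal_eigenbasis (\<lambda>x. - f x) B (\<lambda>b. - l b)"
  using self_adjoint_uminus[OF self_adjoint] orthogonal norm_eq_1 span_eq_UNIV
  by unfold_locales (simp_all add: eigenvector)

lemma inertia:
  "dim {x. f x = 0} + neg_index (quad_form f) UNIV + neg_index (quad_form (\<lambda>x. - f x)) UNIV =
    DIM('a)"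
proof -
  interpret uminus: orthonormal_eigenbasis "\<lambda>x. - f x" B "\<lambda>b. - l b"
    by (rule uminus)
  have "B = {b \<in> B. l b = 0} \<union> {b \<in> B. l b < 0} \<union> {b \<in> B. - l b < 0}"
    by auto
  also have "card \<dots> = card ({b \<in> B. l b = 0} \<union> {b \<in> B. l b < 0}) + card {b \<in> B. - l b < 0}"
    using finite by (intro card_Un_disjoint) auto
  also have "card ({b \<in> B. l b = 0} \<union> {b \<in> B. l b < 0}) =
      card {b \<in> B. l b = 0} + card {b \<in> B. l b < 0}"
    using finite by (intro card_Un_disjoint) auto
  finally show ?thesis
    using eigenspace_eq_span[of 0]
    by (simp add: neg_index_eq_card uminus.neg_index_eq_card card_eq_DIM dim_span_subset
        del: dim_span)
qed

end

lemma self_adjoint_orthonormal_eigenbasis: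
  fixes f :: "'a::euclidean_space \<Rightarrow> 'a"
  assumes f: "self_adjoint f"
  obtains B l where "orthonormal_eigenbasis f B l"
proof -
  define E where "E t = {x. f x = t *\<^sub>R x}" for t
  have "subspace (E t)" for t
    using self_adjoint_linear[OF f]
    by (auto simp: E_def subspace_def linear_0 linear_add linear_scale scaleR_add_right)
  then have "\<exists>B. B \<subseteq> E t \<and> pairwise orthogonal B \<and> (\<forall>b\<in>B. norm b = 1) \<and> span B = E t" for t
    by (metis orthonormal_basis_subspace)
  then obtain B where B: "\<And>t. B t \<subseteq> E t" "\<And>t. pairwise orthogonal (B t)"
      "\<And>t b. b \<in> B t \<Longrightarrow> norm b = 1" "\<And>t. span (B t) = E t"
    by metis
  have E_orthogonal: "orthogonal x y" if "x \<in> E s" "y \<in> E t" "s \<noteq> t" for x y s t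
    using self_adjointD[OF f, of x y] that by (simp add: E_def orthogonal_def)
  have "orthonormal_eigenbasis f (\<Union>t. B t) (quad_form f)"
  proof
    show "pairwise orthogonal (\<Union>t. B t)"
      unfolding pairwise_def using B(1,2) E_orthogonal by (metis UN_E pairwiseD subsetD)
    have "x \<in> span (\<Union>t. B t)" if "x \<in> E t" for x t
      using that B(4)[of t] span_mono[of "B t" "\<Union>t. B t"] by blast
    then have "span {x. \<exists>t. f x = t *\<^sub>R x} \<subseteq> span (\<Union>t. B t)"
      by (intro span_minimal) (auto simp: E_def)
    then show "span (\<Union>t. B t) = UNIV"
      using self_adjoint_span_eigenvectors[OF f] by blast
    show "f b = quad_form f b *\<^sub>R b" if b: "b \<in> (\<Union>t. B t)" for b
    proof -
      obtain t where "b \<in> B t"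
        using b by blast
      then have "f b = t *\<^sub>R b" "norm b = 1"
        using B(1,3) by (auto simp: E_def)
      then show ?thesis
        by (simp add: quad_form_def norm_eq_1)
    qed
  qed (use B(3) f in auto)
  then show ?thesis
    by (rule that)
qed

section \<open>Hermitian matrices\<close>

lemma Re_cinner: "Re (cinner x y) = x \<bullet> y"
  by (simp add: cinner_def inner_vec_def inner_complex_def)

lemma cinner_simps:
  "cinner (x + y) z = cinner x z + cinner y z"
  "cinner z (x + y) = cinner z x + cinner z y"
  "cinner (x - y) z = cinner x z - cinner y z"
  "cinner z (x - y) = cinner z x - cinner z y"
  "cinner (c *s x) z = cnj c * cinner x z"
  "cinner z (c *s x) = c * cinner z x"
  "cinner (- x) z = - cinner x z"
  "cinner z (- x) = - cinner z x"
  "cinner 0 z = 0"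
  "cinner z 0 = 0"
  by (simp_all add: cinner_def algebra_simps sum.distrib sum_subtractf sum_distrib_left sum_negf)

lemma cinner_self: "cinner x x = complex_of_real ((norm x)\<^sup>2)"
proof -
  have "cinner x x = (\<Sum>i\<in>UNIV. complex_of_real ((norm (x $ i))\<^sup>2))"
    by (simp add: cinner_def complex_norm_square mult.commute del: of_real_power)
  also have "\<dots> = complex_of_real ((norm x)\<^sup>2)"
    by (simp add: norm_vec_def L2_set_def sum_nonneg)
  finally show ?thesis .
qed

lemma cinner_eq_0_right_iff: "(\<forall>z. cinner z x = 0) \<longleftrightarrow> x = 0"
proof
  assume "\<forall>z. cinner z x = 0"
  then have "cinner x x = 0" ..
  then show "x = 0"
    by (simp add: cinner_self)
qed (simp add: cinner_simps)

lemma scaleR_eq_vector_scalar_mult: "r *\<^sub>R x = complex_of_real r *s (x :: complex^'n)"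
  by (simp add: vec_eq_iff scaleR_conv_of_real[where 'a = complex])

lemma vec_subspace_imp_subspace: "vec.subspace (V :: (complex^'n) set) \<Longrightarrow> subspace V"
  by (simp add: vec.subspace_def subspace_def scaleR_eq_vector_scalar_mult)

lemma dim_complex_line:
  fixes b :: "complex^'n"
  assumes "b \<noteq> 0"
  shows "dim (range (\<lambda>c. c *s b)) = 2"
proof -
  have "linear (\<lambda>c. c *s b)"
    by (rule linearI)
      (simp_all add: vec.scale_left_distrib scaleR_eq_vector_scalar_mult scaleR_conv_of_real)
  moreover have "inj (\<lambda>c. c *s b)"
    using assms by (auto simp: inj_on_def)
  ultimately show ?thesis
    by (simp add: dim_image_eq)
qed

lemma dim_vec_span:
  fixes B :: "(complex^'n) set"
  assumes "finite B" "vec.independent B"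
  shows "dim (vec.span B) = 2 * card B"
  using assms
proof (induction B rule: finite_induct)
  case (insert b B)
  have b_notin: "b \<notin> vec.span B" and indep: "vec.independent B"
    using insert.prems insert.hyps(2) by (auto simp: vec.independent_insert)
  then have "b \<noteq> 0"
    using vec.span_zero by blast
  have "range (\<lambda>c. c *s b) \<inter> vec.span B \<subseteq> {0}"
  proof
    fix x assume "x \<in> range (\<lambda>c. c *s b) \<inter> vec.span B"
    then obtain c where x_eq: "x = c *s b" and in_span: "c *s b \<in> vec.span B"
      by blast
    then show "x \<in> {0}"
      using b_notin vec.span_scale[OF in_span, of "inverse c"] by (cases "c = 0") auto
  qed
  then have "dim (range (\<lambda>c. c *s b) \<inter> vec.span B) = 0"
    by (simp add: dim_eq_0)
  moreover have "subspace (range (\<lambda>c. c *s b))" "subspace (vec.span B)"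
    using vec.subspace_span[of "{b}"]
    by (auto intro: vec_subspace_imp_subspace simp: vec.span_singleton)
  moreover have "vec.span (insert b B) = {x + y | x y. x \<in> range (\<lambda>c. c *s b) \<and> y \<in> vec.span B}"
    using vec.span_Un[of "{b}" B] by (simp add: vec.span_singleton)
  ultimately have "dim (vec.span (insert b B)) = dim (range (\<lambda>c. c *s b)) + dim (vec.span B)"
    using dim_sums_Int[of "range (\<lambda>c. c *s b)" "vec.span B"] by (simp del: dim_eq_0)
  then show ?case
    using insert.IH[OF indep] insert.hyps by (simp add: dim_complex_line[OF \<open>b \<noteq> 0\<close>])
qed simp

lemma dim_eq_two_times_vec_dim:
  fixes V :: "(complex^'n) set"
  assumes "vec.subspace V"
  shows "dim V = 2 * vec.dim V"
proof -
  obtain B where B: "B \<subseteq> V" "vec.independent B" "V \<subseteq> vec.span B" "card B = vec.dim V"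
    by (rule vec.basis_exists)
  then have "vec.span B = V"
    using assms by (simp add: vec.span_subspace)
  then show ?thesis
    using dim_vec_span[OF vec.finiteI_independent[OF B(2)] B(2)] B(4) by simp
qed

lemma ex_cinner_orthogonal:
  fixes V :: "(complex^'n) set"
  assumes V: "vec.subspace V" "V \<noteq> UNIV"
  obtains y where "y \<noteq> 0" "\<And>v. v \<in> V \<Longrightarrow> cinner v y = 0"
proof -
  have "span V = V"
    using vec_subspace_imp_subspace[OF V(1)] by simp
  then obtain y where y: "y \<noteq> 0" "\<And>v. v \<in> V \<Longrightarrow> v \<bullet> y = 0"
    using span_not_UNIV_orthogonal[of V] V(2) by (metis inner_commute)
  have "cinner v y = 0" if v: "v \<in> V" for v
  proof (rule complex_eqI)
    show "Re (cinner v y) = Re 0"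
      using y(2)[OF v] by (simp add: Re_cinner)
    have "Re (cinner (\<i> *s v) y) = 0"
      using y(2) vec.subspace_scale[OF V(1) v] by (simp add: Re_cinner)
    then show "Im (cinner v y) = Im 0"
      by (simp add: cinner_simps)
  qed
  then show ?thesis
    using that y(1) by blast
qed

lemma hermitian_matrix_iff_cinner:
  "hermitian_matrix A \<longleftrightarrow> (\<forall>x y. cinner (A *v x) y = cinner x (A *v y))"
proof
  assume A: "hermitian_matrix A"
  show "\<forall>x y. cinner (A *v x) y = cinner x (A *v y)"
  proof (intro allI)
    fix x y
    have "cinner (A *v x) y = (\<Sum>i\<in>UNIV. \<Sum>j\<in>UNIV. cnj (A $ i $ j) * cnj (x $ j) * y $ i)"
      by (simp add: cinner_def matrix_vector_mult_def sum_distrib_right)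
    also have "\<dots> = (\<Sum>j\<in>UNIV. \<Sum>i\<in>UNIV. cnj (A $ i $ j) * cnj (x $ j) * y $ i)"
      by (rule sum.swap)
    also have "\<dots> = (\<Sum>j\<in>UNIV. \<Sum>i\<in>UNIV. cnj (x $ j) * (A $ j $ i * y $ i))"
    proof (intro sum.cong refl)
      fix i j
      have "cnj (A $ i $ j) = A $ j $ i"
        using A unfolding hermitian_matrix_def by metis
      then show "cnj (A $ i $ j) * cnj (x $ j) * y $ i = cnj (x $ j) * (A $ j $ i * y $ i)"
        by (simp only: mult.left_commute mult.assoc)
    qed
    also have "\<dots> = cinner x (A *v y)"
      by (simp add: cinner_def matrix_vector_mult_def sum_distrib_left)
    finally show "cinner (A *v x) y = cinner x (A *v y)" .
  qed
next
  assume A: "\<forall>x y. cinner (A *v x) y = cinner x (A *v y)"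
  have "cinner (axis i 1) y = y $ i" "cinner y (axis i 1) = cnj (y $ i)"
    for y :: "complex^'n" and i
    by (simp_all add: cinner_def axis_def if_distrib[of cnj] if_distrib[of "\<lambda>a. a * _"]
        if_distrib[of "\<lambda>a. _ * a"] cong: if_cong)
  moreover have "(A *v axis j 1) $ i = A $ i $ j" for i j
    by (simp add: matrix_vector_mult_def axis_def if_distrib cong: if_cong)
  ultimately show "hermitian_matrix A"
    unfolding hermitian_matrix_def using A by metis
qed

lemma hermitian_cinner: "hermitian_matrix A \<Longrightarrow> cinner (A *v x) y = cinner x (A *v y)"
  by (simp add: hermitian_matrix_iff_cinner)

lemma hermitian_self_adjoint: "hermitian_matrix A \<Longrightarrow> self_adjoint ((*v) A)"
  by (simp add: self_adjoint_def hermitian_cinner flip: Re_cinner)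

lemma hermitian_zero: "hermitian_matrix 0"
  by (simp add: hermitian_matrix_def)

lemma hermitian_diff: "hermitian_matrix A \<Longrightarrow> hermitian_matrix B \<Longrightarrow> hermitian_matrix (A - B)"
  unfolding hermitian_matrix_def by (metis complex_cnj_diff vector_minus_component)

lemma linear_complex_matrix_vector_mult: "linear ((*v) (A :: complex^'n^'m))"
  by (rule linearI)
    (simp_all only: matrix_vector_right_distrib scaleR_eq_vector_scalar_mult vec.scale)

lemma hermitian_sign_splitting:
  assumes "hermitian_matrix A"
  obtains N P where "sign_splitting (quad_form ((*v) A)) N P"
proof -
  obtain B l where "orthonormal_eigenbasis ((*v) A) B l"
    by (rule self_adjoint_orthonormal_eigenbasis[OF hermitian_self_adjoint[OF assms]])
  then show ?thesis
    using that orthonormal_eigenbasis.sign_splitting by blast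
qed

lemma neg_index_hermitian:
  assumes A: "hermitian_matrix A"
  shows "neg_index (quad_form ((*v) A)) UNIV = 2 * n_minus A"
proof -
  obtain B l where "orthonormal_eigenbasis ((*v) A) B l"
    by (rule self_adjoint_orthonormal_eigenbasis[OF hermitian_self_adjoint[OF A]])
  moreover have "dim {x. A *v x = t *\<^sub>R x} = 2 * vec.dim (eigenspace A (complex_of_real t))" for t
  proof -
    have "vec.subspace (eigenspace A (complex_of_real t))"
      by (auto simp: vec.subspace_def eigenspace_def matrix_vector_right_distrib vec.scale
          vec.scale_right_distrib mult.commute)
    then show ?thesis
      using dim_eq_two_times_vec_dim by (simp add: eigenspace_def scaleR_eq_vector_scalar_mult)
  qed
  ultimately show ?thesis
    by (simp add: orthonormal_eigenbasis.neg_index_eq_sum_dims n_minus_def sum_distrib_left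
        scaleR_eq_vector_scalar_mult)
qed

lemma n_minus_diff_inertia:
  fixes A B :: "complex^'n^'n"
  assumes A: "hermitian_matrix A" and B: "hermitian_matrix B"
  shows "dim {x. A *v x = B *v x} + 2 * n_minus (A - B) + 2 * n_minus (B - A) = 2 * CARD('n)"
proof -
  have "self_adjoint ((*v) (A - B))"
    by (intro hermitian_self_adjoint hermitian_diff A B)
  then obtain E l where "orthonormal_eigenbasis ((*v) (A - B)) E l"
    by (rule self_adjoint_orthonormal_eigenbasis)
  then have inertia: "dim {x. (A - B) *v x = 0} + neg_index (quad_form ((*v) (A - B))) UNIV +
      neg_index (quad_form (\<lambda>x. - ((A - B) *v x))) UNIV = 2 * CARD('n)"
    by (simp add: orthonormal_eigenbasis.inertia)
  have "(\<lambda>x. - ((A - B) *v x)) = (*v) (B - A)" "{x. (A - B) *v x = 0} = {x. A *v x = B *v x}"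
    by (simp_all add: fun_eq_iff matrix_vector_mult_diff_rdistrib)
  with inertia show ?thesis
    by (simp only: neg_index_hermitian hermitian_diff A B)
qed

lemma n_minus_diff_triangle:
  assumes A: "hermitian_matrix A" and B: "hermitian_matrix B" and C: "hermitian_matrix C"
  shows "n_minus (C - A) \<le> n_minus (B - A) + n_minus (C - B)"
proof -
  obtain N P where "sign_splitting (quad_form ((*v) (B - A))) N P"
    by (rule hermitian_sign_splitting[OF hermitian_diff[OF B A]])
  from neg_index_add_le[OF this, of "quad_form ((*v) (C - B))"]
  have "neg_index (quad_form ((*v) (C - A))) UNIV
      \<le> neg_index (quad_form ((*v) (B - A))) UNIV + neg_index (quad_form ((*v) (C - B))) UNIV"
    by (simp add: quad_form_def[abs_def] inner_diff_right matrix_vector_mult_diff_rdistrib)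
  then show ?thesis
    by (simp add: neg_index_hermitian hermitian_diff assms)
qed

lemma n_minus_diff_reverse_triangle:
  fixes A B C :: "complex^'n^'n"
  assumes A: "hermitian_matrix A" and B: "hermitian_matrix B" and C: "hermitian_matrix C"
  shows "n_minus (B - A) + n_minus (C - B) \<le> CARD('n) + n_minus (C - A)"
  using n_minus_diff_triangle[OF A C B] n_minus_diff_inertia[OF C B] by linarith

section \<open>The Kashiwara index\<close>

type_synonym 'n phase_space = "(complex^'n) \<times> (complex^'n)"

text \<open>The form \<open>\<Omega>\<close> is determined by its diagonal, of which this is one half; real dimensions are
  twice the complex ones.\<close>

definition kashiwara_form ::
  "'n::finite phase_space \<times> 'n phase_space \<times> 'n phase_space \<Rightarrow> real" where
  "kashiwara_form = (\<lambda>(u, v, w). Re (omega u v + omega v w + omega w u))"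

definition kashiwara_index ::
  "'n::finite phase_space set \<times> 'n phase_space set \<times> 'n phase_space set \<Rightarrow> nat" where
  "kashiwara_index = (\<lambda>(L1, L2, L3).
     (neg_index kashiwara_form (L1 \<times> L2 \<times> L3) + dim (L1 \<inter> L3)) div 2 - CARD('n))"

lemma Re_omega: "Re (omega u v) = fst u \<bullet> snd v - snd u \<bullet> fst v"
  by (simp add: omega_def Re_cinner)

definition pair_sums :: "'a::real_vector \<times> 'a \<times> 'a \<Rightarrow> 'a \<times> 'a \<times> 'a" where
  "pair_sums = (\<lambda>(a, b, c). (a + c, a + b, b + c))"

lemma linear_pair_sums: "linear pair_sums"
  by (rule linearI) (auto simp: pair_sums_def scaleR_add_right)

lemma inj_pair_sums: "inj pair_sums"
proof (rule linear_injective_0[OF linear_pair_sums, THEN iffD2], clarify)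
  fix a b c :: 'a
  assume "pair_sums (a, b, c) = 0"
  then have sums: "a + c = 0" "a + b = 0" "b + c = 0"
    by (simp_all add: pair_sums_def zero_prod_def)
  have "2 *\<^sub>R a = (a + c) + (a + b) - (b + c)"
    by (simp add: scaleR_2)
  then have "a = 0"
    by (simp only: sums) simp
  then show "(a, b, c) = 0"
    using sums(1,2) by (simp add: zero_prod_def)
qed

lemma range_pair_sums: "range (pair_sums :: 'a::euclidean_space \<times> 'a \<times> 'a \<Rightarrow> _) = UNIV"
  by (rule linear_injective_imp_surjective[OF linear_pair_sums inj_pair_sums refl])

text \<open>For \<open>p + r + s = 0\<close> the polynomial \<open>p x y + r y z + s z x\<close> becomes \<open>p a\<^sup>2 + r b\<^sup>2 + s c\<^sup>2\<close>
  under \<open>x = a + c\<close>, \<open>y = a + b\<close>, \<open>z = b + c\<close>.\<close>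

lemma kashiwara_form_graphs_pair_sums:
  fixes A B C :: "complex^'n^'n"
  assumes A: "hermitian_matrix A" and B: "hermitian_matrix B" and C: "hermitian_matrix C"
    and xyz: "(x, y, z) = pair_sums (a, b, c)"
  shows "kashiwara_form ((x, A *v x), (y, B *v y), (z, C *v z)) =
    quad_form ((*v) (B - A)) a + (quad_form ((*v) (C - B)) b + quad_form ((*v) (A - C)) c)"
proof -
  have flip: "(M *v u) \<bullet> v = u \<bullet> (M *v v)" if "M \<in> {A, B, C}" for M u v
    using that A B C hermitian_self_adjoint self_adjointD by blast
  have swap: "b \<bullet> (M *v a) = a \<bullet> (M *v b)" "c \<bullet> (M *v a) = a \<bullet> (M *v c)"
      "c \<bullet> (M *v b) = b \<bullet> (M *v c)" if "M \<in> {A, B, C}" for M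
    using flip[OF that] by (simp_all add: inner_commute)
  have sums: "x = a + c" "y = a + b" "z = b + c"
    using xyz by (simp_all add: pair_sums_def)
  show ?thesis
    by (simp add: sums kashiwara_form_def Re_omega quad_form_def flip swap inner_simps
        matrix_vector_right_distrib matrix_vector_mult_diff_rdistrib)
qed

lemma neg_index_hermitian_sum3:
  assumes X: "hermitian_matrix X" and Y: "hermitian_matrix Y" and Z: "hermitian_matrix Z"
  shows "neg_index (\<lambda>(a, b, c). quad_form ((*v) X) a +
      (quad_form ((*v) Y) b + quad_form ((*v) Z) c)) UNIV =
    2 * (n_minus X + n_minus Y + n_minus Z)"
proof -
  obtain NX PX where splitX: "sign_splitting (quad_form ((*v) X)) NX PX"
    by (rule hermitian_sign_splitting[OF X])
  obtain NY PY where splitY: "sign_splitting (quad_form ((*v) Y)) NY PY"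
    by (rule hermitian_sign_splitting[OF Y])
  obtain NZ PZ where splitZ: "sign_splitting (quad_form ((*v) Z)) NZ PZ"
    by (rule hermitian_sign_splitting[OF Z])
  let ?qYZ = "\<lambda>(b, c). quad_form ((*v) Y) b + quad_form ((*v) Z) c"
  have splitYZ: "sign_splitting ?qYZ (NY \<times> NZ) (PY \<times> PZ)"
    by (rule sign_splitting_Times[OF splitY quad_form_zero splitZ quad_form_zero])
  have "?qYZ 0 = 0"
    by (simp add: zero_prod_def quad_form_zero)
  from neg_index_Times[OF splitX quad_form_zero splitYZ this]
  have "neg_index (\<lambda>(a, bc). quad_form ((*v) X) a + ?qYZ bc) UNIV =
      2 * n_minus X + (2 * n_minus Y + 2 * n_minus Z)"
    by (simp add: neg_index_Times[OF splitY quad_form_zero splitZ quad_form_zero]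
        neg_index_hermitian X Y Z)
  then show ?thesis
    by (simp add: case_prod_unfold)
qed

lemma neg_index_kashiwara_graphs:
  fixes A B C :: "complex^'n^'n"
  assumes A: "hermitian_matrix A" and B: "hermitian_matrix B" and C: "hermitian_matrix C"
  shows "neg_index kashiwara_form (lagr_graph A \<times> lagr_graph B \<times> lagr_graph C) =
    2 * (n_minus (B - A) + n_minus (C - B) + n_minus (A - C))"
proof -
  define f where "f = (\<lambda>(x, y, z). ((x, A *v x), (y, B *v y), (z, C *v z)))"
  have "linear f"
    by (rule linearI)
      (auto simp: f_def linear_add linear_scale linear_complex_matrix_vector_mult)
  moreover have "inj f"
    by (auto simp: f_def inj_def)
  moreover have "range f = lagr_graph A \<times> lagr_graph B \<times> lagr_graph C"
    by (auto simp: f_def lagr_graph_def image_def)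
  ultimately have "neg_index kashiwara_form (lagr_graph A \<times> lagr_graph B \<times> lagr_graph C) =
      neg_index (kashiwara_form \<circ> f) UNIV"
    using neg_index_image[of f UNIV kashiwara_form] by simp
  also have "\<dots> = neg_index (kashiwara_form \<circ> f \<circ> pair_sums) UNIV"
    using neg_index_image[OF linear_pair_sums inj_pair_sums subspace_UNIV]
    by (simp add: range_pair_sums)
  also have "kashiwara_form \<circ> f \<circ> pair_sums = (\<lambda>(a, b, c). quad_form ((*v) (B - A)) a +
      (quad_form ((*v) (C - B)) b + quad_form ((*v) (A - C)) c))"
    using kashiwara_form_graphs_pair_sums[OF A B C] by (auto simp: fun_eq_iff f_def split_beta)
  also have "neg_index \<dots> UNIV = 2 * (n_minus (B - A) + n_minus (C - B) + n_minus (A - C))"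
    by (intro neg_index_hermitian_sum3 hermitian_diff A B C)
  finally show ?thesis .
qed

lemma neg_index_kashiwara_graph_inf:
  fixes A :: "complex^'n^'n"
  assumes A: "hermitian_matrix A"
  shows "neg_index kashiwara_form (lagr_graph 0 \<times> lagr_graph A \<times> lagr_graph_inf) =
    2 * (n_minus A + CARD('n))"
proof -
  define f :: "_ \<Rightarrow> 'n phase_space \<times> 'n phase_space \<times> 'n phase_space"
    where "f = (\<lambda>(y, d, w). ((y + d, 0), (y, A *v y), (0, A *v y + w)))"
  have "linear f"
    by (rule linearI)
      (auto simp: f_def linear_add linear_scale linear_complex_matrix_vector_mult
        scaleR_add_right)
  moreover have "inj f"
    by (auto simp: f_def inj_def)
  moreover have "range f = lagr_graph 0 \<times> lagr_graph A \<times> lagr_graph_inf"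
  proof
    show "range f \<subseteq> lagr_graph 0 \<times> lagr_graph A \<times> lagr_graph_inf"
      by (auto simp: f_def lagr_graph_def lagr_graph_inf_def)
    have "((x, 0), (y, A *v y), (0, z)) \<in> range f" for x y z
      using rangeI[of f "(y, x - y, z - A *v y)"] by (simp add: f_def)
    then show "lagr_graph 0 \<times> lagr_graph A \<times> lagr_graph_inf \<subseteq> range f"
      by (auto simp: lagr_graph_def lagr_graph_inf_def)
  qed
  ultimately have "neg_index kashiwara_form (lagr_graph 0 \<times> lagr_graph A \<times> lagr_graph_inf) =
      neg_index (kashiwara_form \<circ> f) UNIV"
    using neg_index_image[of f UNIV kashiwara_form] by simp
  also have "kashiwara_form \<circ> f = (\<lambda>(y, p). quad_form ((*v) A) y + (\<lambda>(d, w). - (d \<bullet> w)) p)"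
    by (auto simp: fun_eq_iff f_def kashiwara_form_def Re_omega quad_form_def inner_simps
        inner_commute)
  also have "neg_index \<dots> UNIV = 2 * (n_minus A + CARD('n))"
  proof -
    obtain N P where split: "sign_splitting (quad_form ((*v) A)) N P"
      by (rule hermitian_sign_splitting[OF A])
    have "(\<lambda>(d, w). - (d \<bullet> w)) (0 :: (complex^'n) \<times> (complex^'n)) = 0"
      by (simp add: zero_prod_def)
    from neg_index_Times[OF split quad_form_zero sign_splitting_hyperbolic this]
    show ?thesis
      by (simp add: neg_index_hyperbolic neg_index_hermitian[OF A])
  qed
  finally show ?thesis .
qed

lemma dim_lagr_graph_Int:
  fixes A C :: "complex^'n^'n"
  shows "dim (lagr_graph A \<inter> lagr_graph C) = dim {x. C *v x = A *v x}"
proof -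
  have "linear (\<lambda>x. (x, A *v x))"
    by (rule linearI) (simp_all add: linear_add linear_scale linear_complex_matrix_vector_mult)
  moreover have "lagr_graph A \<inter> lagr_graph C = (\<lambda>x. (x, A *v x)) ` {x. C *v x = A *v x}"
    by (auto simp: lagr_graph_def)
  ultimately show ?thesis
    by (simp add: dim_image_eq inj_on_def)
qed

lemma kashiwara_index_graphs:
  fixes A B C :: "complex^'n^'n"
  assumes A: "hermitian_matrix A" and B: "hermitian_matrix B" and C: "hermitian_matrix C"
  shows "int (kashiwara_index (lagr_graph A, lagr_graph B, lagr_graph C)) =
    int (n_minus (B - A)) - int (n_minus (C - A)) + int (n_minus (C - B))"
proof -
  have triangle: "n_minus (C - A) \<le> n_minus (B - A) + n_minus (C - B)"
    by (rule n_minus_diff_triangle[OF A B C])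
  have "2 * (n_minus (B - A) + n_minus (C - B) + n_minus (A - C)) + dim {x. C *v x = A *v x} =
      2 * (n_minus (B - A) + n_minus (C - B) - n_minus (C - A) + CARD('n))"
    using n_minus_diff_inertia[OF C A] triangle by arith
  then have "kashiwara_index (lagr_graph A, lagr_graph B, lagr_graph C) =
      n_minus (B - A) + n_minus (C - B) - n_minus (C - A)"
    by (simp add: kashiwara_index_def neg_index_kashiwara_graphs[OF A B C] dim_lagr_graph_Int)
  then show ?thesis
    using triangle by linarith
qed

lemma kashiwara_index_graph_inf:
  fixes A :: "complex^'n^'n"
  assumes A: "hermitian_matrix A"
  shows "kashiwara_index (lagr_graph 0, lagr_graph A, lagr_graph_inf) = n_minus A"
proof -
  have "lagr_graph 0 \<inter> lagr_graph_inf = {0 :: 'n phase_space}"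
    by (auto simp: lagr_graph_def lagr_graph_inf_def zero_prod_def)
  then show ?thesis
    by (simp add: kashiwara_index_def neg_index_kashiwara_graph_inf[OF A])
qed

section \<open>Symplectic maps and Lagrangian planes\<close>

lemma omega_nondegenerate:
  assumes "\<And>v. omega u v = 0"
  shows "u = 0"
proof -
  have "omega u (- snd u, fst u) = cinner (fst u) (fst u) + cinner (snd u) (snd u)"
    by (simp add: omega_def cinner_simps)
  also have "\<dots> = complex_of_real ((norm (fst u))\<^sup>2 + (norm (snd u))\<^sup>2)"
    by (simp add: cinner_self)
  finally have "(norm (fst u))\<^sup>2 + (norm (snd u))\<^sup>2 = 0"
    using assms by (metis of_real_eq_0_iff)
  then show ?thesis
    by (simp add: sum_power2_eq_zero_iff prod_eq_iff)
qed

lemma scaleR_eq_sympl_scale: "r *\<^sub>R u = sympl.scale (complex_of_real r) u"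
  by (simp add: sympl.scale_def prod_eq_iff scaleR_eq_vector_scalar_mult)

lemma LagrangianI:
  assumes "sympl.p.subspace L" "\<And>v. v \<in> L \<longleftrightarrow> (\<forall>u\<in>L. omega u v = 0)"
  shows "L \<in> Lagrangian"
  using assms unfolding Lagrangian_def by blast

lemma Lagrangian_subspace: "L \<in> Lagrangian \<Longrightarrow> sympl.p.subspace L"
  by (simp add: Lagrangian_def)

lemma Lagrangian_real_subspace: "L \<in> Lagrangian \<Longrightarrow> subspace L"
  using Lagrangian_subspace
  by (auto simp: sympl.p.subspace_def subspace_def scaleR_eq_sympl_scale)

lemma Lagrangian_iff: "L \<in> Lagrangian \<Longrightarrow> v \<in> L \<longleftrightarrow> (\<forall>u\<in>L. omega u v = 0)"
  unfolding Lagrangian_def by blast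

lemma symplecticI:
  assumes "\<And>u v. S (u + v) = S u + S v" "\<And>c u. S (sympl.scale c u) = sympl.scale c (S u)"
    and "\<And>u v. omega (S u) (S v) = omega u v"
  shows "symplectic S"
  unfolding symplectic_def Vector_Spaces.linear_iff
  using assms sympl.p.vector_space_axioms by blast

context
  fixes S :: "'n::finite phase_space \<Rightarrow> 'n phase_space"
  assumes S: "symplectic S"
begin

lemma symplectic_add: "S (u + v) = S u + S v"
  and symplectic_scale: "S (sympl.scale c u) = sympl.scale c (S u)"
  and symplectic_omega: "omega (S u) (S v) = omega u v"
  using S unfolding symplectic_def Vector_Spaces.linear_iff by blast+

lemma symplectic_linear: "linear S"
  by (rule linearI) (simp_all add: symplectic_add symplectic_scale scaleR_eq_sympl_scale)

lemma symplectic_inj: "inj S"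
proof (rule linear_injective_0[OF symplectic_linear, THEN iffD2], intro allI impI)
  fix u assume "S u = 0"
  then have "omega u v = 0" for v
    using symplectic_omega[of u v] by (simp add: omega_def cinner_simps)
  then show "u = 0"
    by (rule omega_nondegenerate)
qed

lemma symplectic_surj: "surj S"
  by (rule linear_injective_imp_surjective[OF symplectic_linear symplectic_inj refl])

lemma symplectic_image_Lagrangian:
  assumes L: "L \<in> Lagrangian"
  shows "S ` L \<in> Lagrangian"
proof (rule LagrangianI)
  show "sympl.p.subspace (S ` L)"
    using S Lagrangian_subspace[OF L] module_hom.subspace_image Vector_Spaces.linear.axioms(3)
    unfolding symplectic_def by blast
  fix v
  obtain w where w: "v = S w"
    using symplectic_surj by (metis surjD)
  have "v \<in> S ` L \<longleftrightarrow> w \<in> L"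
    unfolding w by (rule inj_image_mem_iff[OF symplectic_inj])
  also have "\<dots> \<longleftrightarrow> (\<forall>u\<in>L. omega u w = 0)"
    by (rule Lagrangian_iff[OF L])
  finally show "v \<in> S ` L \<longleftrightarrow> (\<forall>u\<in>S ` L. omega u v = 0)"
    by (simp add: w symplectic_omega)
qed

lemma kashiwara_index_symplectic:
  assumes L: "L1 \<in> Lagrangian" "L2 \<in> Lagrangian" "L3 \<in> Lagrangian"
  shows "kashiwara_index (S ` L1, S ` L2, S ` L3) = kashiwara_index (L1, L2, L3)"
proof -
  define f where "f = (\<lambda>(u, v, w). (S u, S v, S w))"
  have "linear f"
    using symplectic_linear
    by (intro linearI) (simp_all add: f_def case_prod_unfold linear_add linear_scale)
  moreover have "inj f"
    using symplectic_inj by (auto simp: f_def inj_def)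
  moreover have "subspace (L1 \<times> L2 \<times> L3)"
    using L by (intro subspace_Times Lagrangian_real_subspace)
  ultimately have "neg_index kashiwara_form (f ` (L1 \<times> L2 \<times> L3)) =
      neg_index (kashiwara_form \<circ> f) (L1 \<times> L2 \<times> L3)"
    by (rule neg_index_image)
  moreover have "f ` (L1 \<times> L2 \<times> L3) = S ` L1 \<times> S ` L2 \<times> S ` L3"
    unfolding f_def by force
  moreover have "kashiwara_form \<circ> f = kashiwara_form"
    by (auto simp: fun_eq_iff kashiwara_form_def f_def symplectic_omega)
  moreover have "dim (S ` L1 \<inter> S ` L3) = dim (L1 \<inter> L3)"
    using dim_image_eq[OF symplectic_linear inj_on_subset[OF symplectic_inj subset_UNIV]]
    by (simp flip: image_Int[OF symplectic_inj])
  ultimately show ?thesis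
    by (simp add: kashiwara_index_def)
qed

end

lemma lagr_graph_Lagrangian:
  assumes M: "hermitian_matrix M"
  shows "lagr_graph M \<in> Lagrangian"
proof (rule LagrangianI)
  show "sympl.p.subspace (lagr_graph M)"
    by (auto simp: sympl.p.subspace_def lagr_graph_def sympl.scale_def zero_prod_def
        matrix_vector_right_distrib vec.scale)
  fix v
  have "omega (z, M *v z) v = cinner z (snd v - M *v fst v)" for z
    by (simp add: omega_def cinner_simps hermitian_cinner[OF M])
  then have "(\<forall>u\<in>lagr_graph M. omega u v = 0) \<longleftrightarrow> snd v - M *v fst v = 0"
    by (auto simp: lagr_graph_def simp flip: cinner_eq_0_right_iff)
  then show "v \<in> lagr_graph M \<longleftrightarrow> (\<forall>u\<in>lagr_graph M. omega u v = 0)"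
    by (cases v) (auto simp: lagr_graph_def)
qed

lemma lagr_graph_inf_Lagrangian: "lagr_graph_inf \<in> Lagrangian"
proof (rule LagrangianI)
  show "sympl.p.subspace lagr_graph_inf"
    by (auto simp: sympl.p.subspace_def lagr_graph_inf_def sympl.scale_def zero_prod_def)
  show "v \<in> lagr_graph_inf \<longleftrightarrow> (\<forall>u\<in>lagr_graph_inf. omega u v = 0)" for v
    by (cases v) (simp add: lagr_graph_inf_def omega_def cinner_simps cinner_eq_0_right_iff)
qed

definition shear :: "complex^'n^'n \<Rightarrow> 'n phase_space \<Rightarrow> 'n phase_space" where
  "shear M = (\<lambda>(x, y). (x, y + M *v x))"

lemma symplectic_shear:
  assumes M: "hermitian_matrix M"
  shows "symplectic (shear M)"
proof (rule symplecticI; clarify)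
  show "omega (shear M (a, b)) (shear M (a', b')) = omega (a, b) (a', b')" for a b a' b'
    by (simp add: shear_def omega_def cinner_simps hermitian_cinner[OF M])
qed (simp_all add: shear_def sympl.scale_def vec.scale matrix_vector_right_distrib
    vec.scale_right_distrib)

lemma shear_lagr_graph: "shear M ` lagr_graph A = lagr_graph (A + M)"
  by (auto simp: shear_def lagr_graph_def image_def matrix_vector_mult_add_rdistrib)

lemma shear_lagr_graph_inf: "shear M ` lagr_graph_inf = lagr_graph_inf"
  by (auto simp: shear_def lagr_graph_inf_def image_def)

text \<open>Sends the plane \<open>y = t x\<close> to \<open>\<G>\<^sub>\<infinity>\<close>.\<close>

definition slope_to_inf :: "real \<Rightarrow> 'n::finite phase_space \<Rightarrow> 'n phase_space" where
  "slope_to_inf t = (\<lambda>(x, y). (y - complex_of_real t *s x, - x))"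

lemma symplectic_slope_to_inf: "symplectic (slope_to_inf t)"
proof (rule symplecticI; clarify)
  show "omega (slope_to_inf t (a, b)) (slope_to_inf t (a', b')) = omega (a, b) (a', b')"
    for a b a' b' :: "complex^'n"
    by (simp add: slope_to_inf_def omega_def cinner_simps)
qed (simp_all add: slope_to_inf_def sympl.scale_def vec.scale_right_distrib
    vec.scale_right_diff_distrib mult.commute)

text \<open>Isotropy makes vectors \<open>x\<close> with \<open>(x, t x) \<in> L\<close> orthogonal for different real \<open>t\<close>.\<close>

lemma finite_Lagrangian_slopes:
  assumes L: "L \<in> Lagrangian"
  shows "finite {t. \<exists>x. x \<noteq> 0 \<and> (x, complex_of_real t *s x) \<in> L}" (is "finite ?T")
proof -
  have "\<forall>t\<in>?T. \<exists>x. x \<noteq> 0 \<and> (x, complex_of_real t *s x) \<in> L"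
    by blast
  then obtain x where x: "\<forall>t\<in>?T. x t \<noteq> 0 \<and> (x t, complex_of_real t *s x t) \<in> L"
    by (rule bchoice[THEN exE])
  have orth: "x s \<bullet> x t = 0" if "s \<in> ?T" "t \<in> ?T" "s \<noteq> t" for s t
  proof -
    have "omega (x s, complex_of_real s *s x s) (x t, complex_of_real t *s x t) = 0"
      using x that Lagrangian_iff[OF L] by blast
    then have "(complex_of_real t - complex_of_real s) * cinner (x s) (x t) = 0"
      by (simp add: omega_def cinner_simps algebra_simps)
    then show ?thesis
      using that(3) by (simp flip: Re_cinner)
  qed
  have "pairwise orthogonal (x ` ?T)"
    using orth by (auto simp: pairwise_def orthogonal_def)
  then have "finite (x ` ?T)"
    by (rule pairwise_orthogonal_imp_finite)
  moreover have "inj_on x ?T"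
    using orth x by (metis (no_types, lifting) inj_onI inner_eq_zero_iff)
  ultimately show ?thesis
    by (rule finite_imageD)
qed

lemma Lagrangian_transversal_fst_surj:
  assumes L: "L \<in> Lagrangian" and transversal: "\<And>y. (0, y) \<in> L \<Longrightarrow> y = 0"
  shows "fst ` L = UNIV"
proof (rule ccontr)
  assume "fst ` L \<noteq> UNIV"
  moreover have "vec.subspace (fst ` L)"
    using module_hom.subspace_image[OF Vector_Spaces.linear.axioms(3)[OF sympl.linear_fst]]
      Lagrangian_subspace[OF L] by blast
  ultimately obtain y where "y \<noteq> 0" "\<And>v. v \<in> fst ` L \<Longrightarrow> cinner v y = 0"
    using ex_cinner_orthogonal by metis
  then have "\<forall>u\<in>L. omega u (0, y) = 0"
    by (simp add: omega_def cinner_simps)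
  then show False
    using transversal \<open>y \<noteq> 0\<close> Lagrangian_iff[OF L] by blast
qed

lemma Lagrangian_transversal_eq_lagr_graph:
  assumes L: "L \<in> Lagrangian" and transversal: "\<And>y. (0, y) \<in> L \<Longrightarrow> y = 0"
  obtains M where "hermitian_matrix M" "L = lagr_graph M"
proof -
  note subspace = Lagrangian_subspace[OF L]
  have unique: "y = z" if "(x, y) \<in> L" "(x, z) \<in> L" for x y z
    using transversal[of "y - z"] sympl.p.subspace_diff[OF subspace that] by simp
  have "\<forall>x. \<exists>y. (x, y) \<in> L"
    using Lagrangian_transversal_fst_surj[OF assms] by (metis UNIV_I imageE prod.collapse)
  then obtain g where g: "\<And>x. (x, g x) \<in> L"
    by metis
  have "g (x + y) = g x + g y" "g (c *s x) = c *s g x" for x y c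
    using unique[OF g] sympl.p.subspace_add[OF subspace g g] sympl.p.subspace_scale[OF subspace g]
    by (simp_all add: sympl.scale_prod)
  then have "Vector_Spaces.linear (*s) (*s) g"
    by (simp add: Vector_Spaces.linear_iff vec.vector_space_axioms)
  then have matrix: "matrix g *v x = g x" for x
    by (rule matrix_works)
  have "omega (x, g x) (y, g y) = 0" for x y
    using g Lagrangian_iff[OF L] by blast
  then have "cinner (g x) y = cinner x (g y)" for x y
    by (simp add: omega_def)
  then have "hermitian_matrix (matrix g)"
    by (simp add: hermitian_matrix_iff_cinner matrix)
  moreover have "L = lagr_graph (matrix g)"
    using g unique by (auto simp: lagr_graph_def matrix)
  ultimately show ?thesis
    by (rule that)
qed

lemma finite_Lagrangians_simultaneous_graphs:
  fixes F :: "'n::finite phase_space set set"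
  assumes F: "finite F" "F \<subseteq> Lagrangian"
  obtains S M where "symplectic S" "\<And>L. L \<in> F \<Longrightarrow> hermitian_matrix (M L)"
    "\<And>L. L \<in> F \<Longrightarrow> S ` L = lagr_graph (M L)"
proof -
  have "finite (\<Union>L\<in>F. {t. \<exists>x. x \<noteq> 0 \<and> (x, complex_of_real t *s x) \<in> L})"
    using F finite_Lagrangian_slopes by blast
  then obtain t where t: "t \<notin> (\<Union>L\<in>F. {t. \<exists>x. x \<noteq> 0 \<and> (x, complex_of_real t *s x) \<in> L})"
    using ex_new_if_finite[OF infinite_UNIV_char_0] by blast
  have "\<exists>M. hermitian_matrix M \<and> slope_to_inf t ` L = lagr_graph M" if L: "L \<in> F" for L
  proof -
    have "y = 0" if vertical: "(0, y) \<in> slope_to_inf t ` L" for y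
    proof -
      obtain x where "(x, complex_of_real t *s x) \<in> L" "y = - x"
        using vertical by (auto simp: slope_to_inf_def)
      then show ?thesis
        using t L by auto
    qed
    moreover have "slope_to_inf t ` L \<in> Lagrangian"
      using symplectic_image_Lagrangian[OF symplectic_slope_to_inf] F(2) L by blast
    ultimately show ?thesis
      using Lagrangian_transversal_eq_lagr_graph by metis
  qed
  then obtain M where "\<forall>L\<in>F. hermitian_matrix (M L) \<and> slope_to_inf t ` L = lagr_graph (M L)"
    by metis
  then show ?thesis
    using that[of "slope_to_inf t" M] symplectic_slope_to_inf by blast
qed

section \<open>The Duistermaat index\<close>

lemma kashiwara_index_on_finite_set:
  fixes F :: "'n::finite phase_space set set"
  assumes F: "finite F" "F \<subseteq> Lagrangian"
  obtains M :: "'n phase_space set \<Rightarrow> complex^'n^'n"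
  where "\<And>L. L \<in> F \<Longrightarrow> hermitian_matrix (M L)"
    "\<And>L1 L2 L3. {L1, L2, L3} \<subseteq> F \<Longrightarrow> int (kashiwara_index (L1, L2, L3)) =
      int (n_minus (M L2 - M L1)) - int (n_minus (M L3 - M L1)) + int (n_minus (M L3 - M L2))"
proof -
  obtain S M where S: "symplectic S" and hermitian: "\<And>L. L \<in> F \<Longrightarrow> hermitian_matrix (M L)"
    and graph: "\<And>L. L \<in> F \<Longrightarrow> S ` L = lagr_graph (M L)"
    by (rule finite_Lagrangians_simultaneous_graphs[OF F]) blast
  have "int (kashiwara_index (L1, L2, L3)) =
      int (n_minus (M L2 - M L1)) - int (n_minus (M L3 - M L1)) + int (n_minus (M L3 - M L2))"
    if L: "{L1, L2, L3} \<subseteq> F" for L1 L2 L3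
  proof -
    have "kashiwara_index (L1, L2, L3) = kashiwara_index (S ` L1, S ` L2, S ` L3)"
      using L F(2) by (intro kashiwara_index_symplectic[OF S, symmetric]) blast+
    then show ?thesis
      using L by (simp add: graph hermitian kashiwara_index_graphs)
  qed
  then show ?thesis
    using that hermitian by blast
qed

lemma kashiwara_index_le:
  fixes L1 L2 L3 :: "'n::finite phase_space set"
  assumes "L1 \<in> Lagrangian" "L2 \<in> Lagrangian" "L3 \<in> Lagrangian"
  shows "kashiwara_index (L1, L2, L3) \<le> CARD('n)"
proof -
  have "finite {L1, L2, L3}" "{L1, L2, L3} \<subseteq> Lagrangian"
    using assms by auto
  then obtain M :: "'n phase_space set \<Rightarrow> complex^'n^'n"
    where hermitian: "\<And>L. L \<in> {L1, L2, L3} \<Longrightarrow> hermitian_matrix (M L)"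
      and index: "int (kashiwara_index (L1, L2, L3)) =
        int (n_minus (M L2 - M L1)) - int (n_minus (M L3 - M L1)) + int (n_minus (M L3 - M L2))"
    by (rule kashiwara_index_on_finite_set) blast
  show ?thesis
    using n_minus_diff_reverse_triangle[of "M L1" "M L2" "M L3"] index hermitian by simp
qed

lemma kashiwara_index_cocycle:
  fixes L1 L2 L3 L4 :: "'n::finite phase_space set"
  assumes "L1 \<in> Lagrangian" "L2 \<in> Lagrangian" "L3 \<in> Lagrangian" "L4 \<in> Lagrangian"
  shows "int (kashiwara_index (L1, L2, L3)) - int (kashiwara_index (L1, L2, L4)) +
    int (kashiwara_index (L1, L3, L4)) - int (kashiwara_index (L2, L3, L4)) = 0"
proof -
  have "finite {L1, L2, L3, L4}" "{L1, L2, L3, L4} \<subseteq> Lagrangian"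
    using assms by auto
  then obtain M :: "'n phase_space set \<Rightarrow> complex^'n^'n"
    where "\<And>K1 K2 K3. {K1, K2, K3} \<subseteq> {L1, L2, L3, L4} \<Longrightarrow> int (kashiwara_index (K1, K2, K3)) =
      int (n_minus (M K2 - M K1)) - int (n_minus (M K3 - M K1)) + int (n_minus (M K3 - M K2))"
    by (rule kashiwara_index_on_finite_set) blast
  then show ?thesis
    by simp
qed

theorem is_duistermaat_index_kashiwara_index:
  "is_duistermaat_index (restrict kashiwara_index (Lagrangian \<times> Lagrangian \<times> Lagrangian))"
  unfolding is_duistermaat_index_def
  using kashiwara_index_le kashiwara_index_graph_inf kashiwara_index_symplectic
    kashiwara_index_cocycle
  by (auto simp: lagr_graph_Lagrangian hermitian_zero lagr_graph_inf_Lagrangian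
      symplectic_image_Lagrangian)

context
  fixes \<iota> :: "'n::finite phase_space set \<times> 'n phase_space set \<times> 'n phase_space set \<Rightarrow> nat"
  assumes \<iota>: "is_duistermaat_index \<iota>"
begin

lemma duistermaat_extensional:
  "\<iota> \<in> Lagrangian \<times> Lagrangian \<times> Lagrangian \<rightarrow>\<^sub>E {0..CARD('n)}"
  and duistermaat_graph_inf:
    "hermitian_matrix A \<Longrightarrow> \<iota> (lagr_graph 0, lagr_graph A, lagr_graph_inf) = n_minus A"
  and duistermaat_symplectic:
    "symplectic S \<Longrightarrow> L1 \<in> Lagrangian \<Longrightarrow> L2 \<in> Lagrangian \<Longrightarrow> L3 \<in> Lagrangian \<Longrightarrow>
      \<iota> (S ` L1, S ` L2, S ` L3) = \<iota> (L1, L2, L3)"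
  and duistermaat_cocycle:
    "L1 \<in> Lagrangian \<Longrightarrow> L2 \<in> Lagrangian \<Longrightarrow> L3 \<in> Lagrangian \<Longrightarrow> L4 \<in> Lagrangian \<Longrightarrow>
      int (\<iota> (L1, L2, L3)) - int (\<iota> (L1, L2, L4)) + int (\<iota> (L1, L3, L4))
        - int (\<iota> (L2, L3, L4)) = 0"
  using \<iota> unfolding is_duistermaat_index_def by blast+

lemma duistermaat_graphs_inf:
  assumes A: "hermitian_matrix A" and B: "hermitian_matrix B"
  shows "\<iota> (lagr_graph A, lagr_graph B, lagr_graph_inf) = n_minus (B - A)"
proof -
  have "\<iota> (lagr_graph A, lagr_graph B, lagr_graph_inf) =
      \<iota> (shear A ` lagr_graph 0, shear A ` lagr_graph (B - A), shear A ` lagr_graph_inf)"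
    by (simp add: shear_lagr_graph shear_lagr_graph_inf)
  also have "\<dots> = \<iota> (lagr_graph 0, lagr_graph (B - A), lagr_graph_inf)"
    by (intro duistermaat_symplectic symplectic_shear lagr_graph_Lagrangian
        lagr_graph_inf_Lagrangian hermitian_zero hermitian_diff A B)
  also have "\<dots> = n_minus (B - A)"
    by (intro duistermaat_graph_inf hermitian_diff A B)
  finally show ?thesis .
qed

lemma duistermaat_graphs:
  assumes A: "hermitian_matrix A" and B: "hermitian_matrix B" and C: "hermitian_matrix C"
  shows "int (\<iota> (lagr_graph A, lagr_graph B, lagr_graph C)) =
    int (n_minus (B - A)) - int (n_minus (C - A)) + int (n_minus (C - B))"
  using duistermaat_cocycle[of "lagr_graph A" "lagr_graph B" "lagr_graph C" lagr_graph_inf]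
  by (simp add: lagr_graph_Lagrangian lagr_graph_inf_Lagrangian duistermaat_graphs_inf A B C)

end

lemma is_duistermaat_index_unique:
  fixes \<iota> \<kappa> :: "'n::finite phase_space set \<times> 'n phase_space set \<times> 'n phase_space set \<Rightarrow> nat"
  assumes \<iota>: "is_duistermaat_index \<iota>" and \<kappa>: "is_duistermaat_index \<kappa>"
  shows "\<iota> = \<kappa>"
proof (rule PiE_ext[OF duistermaat_extensional[OF \<iota>] duistermaat_extensional[OF \<kappa>]], clarify)
  fix L1 L2 L3 :: "'n phase_space set"
  assume L: "L1 \<in> Lagrangian" "L2 \<in> Lagrangian" "L3 \<in> Lagrangian"
  then have "finite {L1, L2, L3}" "{L1, L2, L3} \<subseteq> Lagrangian"
    by auto
  then obtain S M where S: "symplectic S"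
    and hermitian: "\<And>L. L \<in> {L1, L2, L3} \<Longrightarrow> hermitian_matrix (M L)"
    and graph: "\<And>L. L \<in> {L1, L2, L3} \<Longrightarrow> S ` L = lagr_graph (M L)"
    by (rule finite_Lagrangians_simultaneous_graphs) blast
  have "int (\<iota> (S ` L1, S ` L2, S ` L3)) = int (\<kappa> (S ` L1, S ` L2, S ` L3))"
    by (simp add: graph hermitian duistermaat_graphs[OF \<iota>] duistermaat_graphs[OF \<kappa>])
  then show "\<iota> (L1, L2, L3) = \<kappa> (L1, L2, L3)"
    by (simp add: duistermaat_symplectic[OF \<iota> S L] duistermaat_symplectic[OF \<kappa> S L])
qed

theorem theorem1p4:
  fixes A B C :: "complex^'n^'n"
  assumes "hermitian_matrix A" and "hermitian_matrix B" and "hermitian_matrix C"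
  shows "int (duistermaat_index (lagr_graph A, lagr_graph B, lagr_graph C)) =
           int (n_minus (B - A)) - int (n_minus (C - A)) + int (n_minus (C - B))"
proof -
  have "is_duistermaat_index (duistermaat_index :: 'n phase_space set \<times> _ \<Rightarrow> nat)"
    unfolding duistermaat_index_def
    by (rule theI[where P = is_duistermaat_index, OF is_duistermaat_index_kashiwara_index])
      (rule is_duistermaat_index_unique[OF _ is_duistermaat_index_kashiwara_index])
  then show ?thesis
    using assms by (rule duistermaat_graphs)
qed

end
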